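(* For each $i\ge 1$ let $B(2,i)$ be a binary de Bruijn sequence of order $i$, and let $\alpha\in[0,1)$ be the real number whose binary expansion is $$\alpha = 0\,.\,B(2,1)^{1^1}\, B(2,2)^{2^2}\, B(2,3)^{3^3}\cdots B(2,i)^{i^i}\cdots .$$ Then $\alpha$ is normal to the base $2$.
   Context: A binary de Bruijn sequence $B(2,i)$ of order $i$ is a finite string over $\{0,1\}$ of length $2^i$ in which, read cyclically (i.e. also counting occurrences that wrap around from the end of the string to its beginning), every string in $\{0,1\}^i$ occurs exactly once. For a string $w$ and a positive integer $t$, $w^t$ denotes the concatenation of $t$ copies of $w$; juxtaposition of strings denotes concatenation. A real number with binary expansion $0.x_0x_1x_2\dots$ is normal to the base $2$ if for every $m\ge 1$ and every $w\in\{0,1\}^m$, the number of indices $n$ with $0\le n\le j-m$ and $x_n x_{n+1}\cdots x_{n+m-1}=w$ equals $2^{-m}j+o(j)$ as $j\to\infty$. *)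

theory Defs
  imports Complex_Main "HOL-Library.Landau_Symbols"
begin

definition binary_word :: "nat list \<Rightarrow> bool" where
  "binary_word w \<longleftrightarrow> set w \<subseteq> {0, 1}"

(* Since i <= 2^i, the string read cyclically from position p, of length i, is
   the length-i prefix of the rotation of s by p. *)
definition de_bruijn :: "nat \<Rightarrow> nat list \<Rightarrow> bool" where
  "de_bruijn i s \<longleftrightarrow> binary_word s \<and> length s = 2 ^ i \<and>
     (\<forall>w. binary_word w \<and> length w = i \<longrightarrow> (\<exists>!p. p < 2 ^ i \<and> take i (rotate p s) = w))"

definition word_power :: "nat list \<Rightarrow> nat \<Rightarrow> nat list" where
  "word_power w t = concat (replicate t w)"

(* B(1)^(1^1) B(2)^(2^2) ... B(k)^(k^k) *)
definition power_concat :: "(nat \<Rightarrow> nat list) \<Rightarrow> nat \<Rightarrow> nat list" where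
  "power_concat B k = concat (map (\<lambda>i. word_power (B i) (i ^ i)) [1..<Suc k])"

(* The infinite concatenation. If every B i with i >= 1 is nonempty, then position n
   already lies within the first n + 1 blocks, and any larger number of blocks gives
   the same symbol; see power_concat_limit_eq. *)
definition power_concat_limit :: "(nat \<Rightarrow> nat list) \<Rightarrow> nat \<Rightarrow> nat" where
  "power_concat_limit B n = power_concat B (Suc n) ! n"

definition has_binary_expansion :: "real \<Rightarrow> (nat \<Rightarrow> nat) \<Rightarrow> bool" where
  "has_binary_expansion \<alpha> x \<longleftrightarrow>
     (\<forall>n. x n \<in> {0, 1}) \<and> (\<lambda>n. real (x n) / 2 ^ Suc n) sums \<alpha>"

(* For dyadic rationals this selects the expansion ending in zeros. *)
definition binary_digit :: "real \<Rightarrow> nat \<Rightarrow> nat" where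
  "binary_digit \<alpha> n = nat (\<lfloor>2 ^ Suc n * \<alpha>\<rfloor> mod 2)"

(* n + length w <= j rather than n <= j - length w, as subtraction on nat truncates. *)
definition occurrences :: "(nat \<Rightarrow> nat) \<Rightarrow> nat list \<Rightarrow> nat \<Rightarrow> nat" where
  "occurrences x w j = card {n. n + length w \<le> j \<and> map x [n..<n + length w] = w}"

definition normal_base2 :: "real \<Rightarrow> bool" where
  "normal_base2 \<alpha> \<longleftrightarrow>
     (\<forall>m\<ge>1. \<forall>w. binary_word w \<and> length w = m \<longrightarrow>
        (\<lambda>j. real (occurrences (binary_digit \<alpha>) w j) - real j / 2 ^ m) \<in> o(\<lambda>j. real j))"

lemma power_concat_Suc:
  "power_concat B (Suc k) = power_concat B k @ word_power (B (Suc k)) (Suc k ^ Suc k)"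
  by (simp add: power_concat_def)

lemma length_power_concat_ge:
  assumes "\<And>i. i \<ge> 1 \<Longrightarrow> B i \<noteq> []"
  shows "k \<le> length (power_concat B k)"
proof (induction k)
  case (Suc k)
  have "word_power (B (Suc k)) (Suc k ^ Suc k) \<noteq> []"
    using assms[of "Suc k"] by (auto simp: word_power_def)
  then have "length (word_power (B (Suc k)) (Suc k ^ Suc k)) \<ge> 1"
    by (simp add: Suc_le_eq)
  with Suc show ?case by (simp add: power_concat_Suc)
qed simp

lemma power_concat_nth_mono:
  assumes "n < length (power_concat B k)" and "k \<le> l"
  shows "power_concat B l ! n = power_concat B k ! n \<and> n < length (power_concat B l)"
  using assms(2)
proof (induction l rule: dec_induct)
  case base
  then show ?case using assms(1) by simp
next
  case (step l)
  then show ?case by (simp add: power_concat_Suc nth_append)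
qed

lemma power_concat_limit_eq:
  assumes "\<And>i. i \<ge> 1 \<Longrightarrow> B i \<noteq> []" and "n < length (power_concat B k)"
  shows "power_concat_limit B n = power_concat B k ! n"
proof -
  have "n < length (power_concat B (Suc n))"
    using length_power_concat_ge[of B "Suc n"] assms(1) by (simp add: Suc_le_eq)
  then show ?thesis
    using power_concat_nth_mono[of n B "Suc n" k] power_concat_nth_mono[of n B k "Suc n"] assms(2)
    unfolding power_concat_limit_def by (cases "Suc n \<le> k") auto
qed

lemma has_binary_expansion_binary_digit:
  assumes "\<alpha> \<in> {0..<1}"
  shows "has_binary_expansion \<alpha> (binary_digit \<alpha>)"
proof -
  have digit: "real (binary_digit \<alpha> n) = of_int \<lfloor>2 ^ Suc n * \<alpha>\<rfloor> - 2 * of_int \<lfloor>2 ^ n * \<alpha>\<rfloor>" for n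
  proof -
    have "\<lfloor>2 ^ Suc n * \<alpha>\<rfloor> div 2 = \<lfloor>2 ^ n * \<alpha>\<rfloor>"
      using floor_divide_real_eq_div[of 2 "2 ^ Suc n * \<alpha>"] by simp
    then have "\<lfloor>2 ^ Suc n * \<alpha>\<rfloor> mod 2 = \<lfloor>2 ^ Suc n * \<alpha>\<rfloor> - 2 * \<lfloor>2 ^ n * \<alpha>\<rfloor>"
      by (metis minus_mult_div_eq_mod)
    moreover have "real (binary_digit \<alpha> n) = of_int (\<lfloor>2 ^ Suc n * \<alpha>\<rfloor> mod 2)"
      unfolding binary_digit_def by (subst of_nat_nat) auto
    ultimately show ?thesis by simp
  qed
  have partial: "(\<Sum>n<k. real (binary_digit \<alpha> n) / 2 ^ Suc n) = of_int \<lfloor>2 ^ k * \<alpha>\<rfloor> / 2 ^ k" for k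
  proof (induction k)
    case 0
    have "\<lfloor>\<alpha>\<rfloor> = 0" using assms by (simp add: floor_eq_iff)
    then show ?case by simp
  next
    case (Suc k)
    then show ?case using digit[of k] by (simp add: field_simps)
  qed
  have "(\<lambda>k. of_int \<lfloor>2 ^ k * \<alpha>\<rfloor> / 2 ^ k) \<longlonglongrightarrow> \<alpha>"
  proof (rule real_tendsto_sandwich)
    show "\<forall>\<^sub>F k in sequentially. \<alpha> - (1 / 2) ^ k \<le> of_int \<lfloor>2 ^ k * \<alpha>\<rfloor> / 2 ^ k"
    proof (rule always_eventually, rule allI)
      fix k :: nat
      have "2 ^ k * \<alpha> - 1 \<le> of_int \<lfloor>2 ^ k * \<alpha>\<rfloor>" by linarith
      then have "(2 ^ k * \<alpha> - 1) / 2 ^ k \<le> of_int \<lfloor>2 ^ k * \<alpha>\<rfloor> / 2 ^ k"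
        by (rule divide_right_mono) simp
      then show "\<alpha> - (1 / 2) ^ k \<le> of_int \<lfloor>2 ^ k * \<alpha>\<rfloor> / 2 ^ k"
        by (simp add: diff_divide_distrib power_divide)
    qed
    show "\<forall>\<^sub>F k in sequentially. of_int \<lfloor>2 ^ k * \<alpha>\<rfloor> / 2 ^ k \<le> \<alpha>"
      by (rule always_eventually) (simp add: pos_divide_le_eq mult.commute)
    have "(\<lambda>k. (1 / 2 :: real) ^ k) \<longlonglongrightarrow> 0" by (rule LIMSEQ_power_zero) simp
    then show "(\<lambda>k. \<alpha> - (1 / 2) ^ k) \<longlonglongrightarrow> \<alpha>"
      using tendsto_diff[OF tendsto_const[of \<alpha>]] by fastforce
  qed simp
  then have "(\<lambda>n. real (binary_digit \<alpha> n) / 2 ^ Suc n) sums \<alpha>"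
    unfolding sums_def partial .
  moreover have "binary_digit \<alpha> n \<in> {0, 1}" for n
  proof -
    have "\<lfloor>2 ^ Suc n * \<alpha>\<rfloor> mod 2 = 0 \<or> \<lfloor>2 ^ Suc n * \<alpha>\<rfloor> mod 2 = 1" by presburger
    then show ?thesis unfolding binary_digit_def by auto
  qed
  ultimately show ?thesis unfolding has_binary_expansion_def by blast
qed

end

theory Submission
  imports Defs
begin

text \<open>
  Every word of length \<open>m\<close> occurs exactly \<open>2 ^ (i - m)\<close> times cyclically in a de Bruijn sequence of
  order \<open>i \<ge> m\<close>. Hence the deviation of the occurrence count from its expected value sums to \<open>0\<close> over
  each copy of \<open>B(2,i)\<close> that is followed by another copy, so that inside the \<open>i\<close>-th power it never
  grows by more than \<open>2 ^ i\<close>, the length of one copy. At a position \<open>j\<close> in the power of index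
  \<open>k + 1\<close> the total deviation is thus at most \<open>C + 2 ^ (k + 2)\<close>, whereas
  \<open>j \<ge> k ^ k * 2 ^ k\<close>. As every \<open>B(2,i)\<close> contains a \<open>0\<close>, the expansion does not end in ones, and
  therefore it is the expansion that \<open>binary_digit\<close> selects.
\<close>

section \<open>Uniqueness of the binary expansion\<close>

text \<open>Multiplication by \<open>2 ^ n\<close> turns the first \<open>n\<close> digits into an
  integer and leaves the tail \<open>T n\<close>. A later digit 0 forces \<open>T n < 1\<close>, so
  the floor is exactly that integer, whose parity is its last digit.\<close>

lemma binary_digit_unique:
  assumes "has_binary_expansion \<alpha> x" and zeros: "\<And>N. \<exists>n\<ge>N. x n = 0"
  shows "binary_digit \<alpha> n = x n"
proof -
  define T where "T n = (\<Sum>k. real (x (k + n)) / 2 ^ Suc k)" for n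
  have x01: "x n = 0 \<or> x n = 1" for n
    using assms(1) by (auto simp: has_binary_expansion_def)
  have geometric: "(\<lambda>k. 1 / 2 ^ Suc k :: real) sums 1"
    using power_half_series by (simp add: power_divide)
  have summable_T: "summable (\<lambda>k. real (x (k + n)) / 2 ^ Suc k)" for n
  proof (rule summable_comparison_test'[OF sums_summable[OF geometric], of 0])
    show "norm (real (x (k + n)) / 2 ^ Suc k) \<le> 1 / 2 ^ Suc k" for k
      using x01[of "k + n"] by auto
  qed
  have T_nonneg: "0 \<le> T n" for n
    unfolding T_def by (rule suminf_nonneg[OF summable_T]) simp
  have T_less: "T n < 1" for n
  proof -
    obtain k where k: "k \<ge> n" "x k = 0" using zeros by blast
    have d: "(\<lambda>k. 1 / 2 ^ Suc k - real (x (k + n)) / 2 ^ Suc k) sums (1 - T n)"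
      unfolding T_def by (intro sums_diff geometric summable_sums summable_T)
    \<comment> \<open>\<open>1 - T n\<close> is a series of nonnegative terms, and the digit 0 at
      position \<open>k\<close> makes one of them positive.\<close>
    have "0 < (\<Sum>k. 1 / 2 ^ Suc k - real (x (k + n)) / 2 ^ Suc k)"
    proof (rule suminf_pos2[OF sums_summable[OF d], of "k - n"])
      show "0 \<le> 1 / 2 ^ Suc k - real (x (k + n)) / 2 ^ Suc k" for k
        using x01[of "k + n"] by auto
      show "0 < 1 / 2 ^ Suc (k - n) - real (x (k - n + n)) / 2 ^ Suc (k - n)"
        using k by simp
    qed
    then show ?thesis using sums_unique[OF d] by simp
  qed
  have T_Suc: "2 * T n = real (x n) + T (Suc n)" for n
    using suminf_split_head[OF summable_T[of n]] suminf_mult[OF summable_T[of "Suc n"], of "1 / 2"]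
    by (simp add: T_def)
  have "\<alpha> = T 0"
    using assms(1) by (simp add: T_def has_binary_expansion_def sums_unique)
  have shift: "\<exists>N::int. 2 ^ n * \<alpha> = of_int N + T n" for n
  proof (induction n)
    case 0
    show ?case using \<open>\<alpha> = T 0\<close> by (intro exI[of _ 0]) simp
  next
    case (Suc n)
    then obtain N :: int where "2 ^ n * \<alpha> = of_int N + T n" by blast
    then show ?case using T_Suc[of n] by (intro exI[of _ "2 * N + int (x n)"]) simp
  qed
  obtain N :: int where "2 ^ n * \<alpha> = of_int N + T n" using shift by blast
  then have "2 ^ Suc n * \<alpha> = of_int (2 * N + int (x n)) + T (Suc n)"
    using T_Suc[of n] by simp
  then have "\<lfloor>2 ^ Suc n * \<alpha>\<rfloor> = 2 * N + int (x n)"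
    using T_nonneg[of "Suc n"] T_less[of "Suc n"] by (intro floor_unique) simp_all
  then show ?thesis
    using x01[of n] by (auto simp: binary_digit_def)
qed

section \<open>Subword counts in de Bruijn sequences\<close>

lemma card_binary_words_prefix:
  assumes "binary_word w" and "length w = m" and "m \<le> i"
  shows "card {u. binary_word u \<and> length u = i \<and> take m u = w} = 2 ^ (i - m)"
proof -
  have "bij_betw ((@) w) {v. set v \<subseteq> {0, 1} \<and> length v = i - m}
      {u. binary_word u \<and> length u = i \<and> take m u = w}"
  proof (rule bij_betw_byWitness[where f' = "drop m"])
    show "\<forall>u\<in>{u. binary_word u \<and> length u = i \<and> take m u = w}. w @ drop m u = u"
      using append_take_drop_id by blast
    show "drop m ` {u. binary_word u \<and> length u = i \<and> take m u = w}
        \<subseteq> {v. set v \<subseteq> {0, 1} \<and> length v = i - m}"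
      by (auto simp: binary_word_def dest!: in_set_dropD)
  qed (use assms in \<open>auto simp: binary_word_def\<close>)
  then show ?thesis
    using card_lists_length_eq[of "{0, 1 :: nat}" "i - m"]
    by (simp add: bij_betw_same_card[symmetric] numeral_2_eq_2)
qed

text \<open>Positions correspond bijectively to the words of length \<open>i\<close> read there
  cyclically. The word \<open>w\<close> starts at a position exactly if the longer word has prefix
  \<open>w\<close>, so it is enough to count the extensions of \<open>w\<close>.\<close>

lemma de_bruijn_card_prefix:
  assumes "de_bruijn i s" and "binary_word w" and "length w = m" and "m \<le> i"
  shows "card {r. r < 2 ^ i \<and> take m (rotate r s) = w} = 2 ^ (i - m)"
proof -
  let ?window = "\<lambda>p. take i (rotate p s)"
  have s: "binary_word s" "length s = 2 ^ i"
    and ex1: "\<And>w. binary_word w \<Longrightarrow> length w = i \<Longrightarrow> \<exists>!p. p < 2 ^ i \<and> ?window p = w"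
    using assms(1) by (auto simp: de_bruijn_def)
  \<comment> \<open>Since \<open>i < 2 ^ i\<close>, \<open>take i\<close> finds a full
    window.\<close>
  have window: "binary_word (?window p)" "length (?window p) = i" for p
    using s less_exp[of i] by (auto simp: binary_word_def dest!: in_set_takeD)
  have prefix: "take m (?window p) = take m (rotate p s)" for p
    using assms(4) by (simp add: min_def)
  have "bij_betw ?window {r. r < 2 ^ i \<and> take m (rotate r s) = w}
      {u. binary_word u \<and> length u = i \<and> take m u = w}"
    unfolding bij_betw_def
  proof (intro conjI inj_onI equalityI subsetI)
    fix p q
    assume "p \<in> {r. r < 2 ^ i \<and> take m (rotate r s) = w}"
      "q \<in> {r. r < 2 ^ i \<and> take m (rotate r s) = w}" "?window p = ?window q"
    then show "p = q" using ex1[OF window, of p] by auto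
  next
    fix u assume "u \<in> ?window ` {r. r < 2 ^ i \<and> take m (rotate r s) = w}"
    then show "u \<in> {u. binary_word u \<and> length u = i \<and> take m u = w}"
      using window prefix by auto
  next
    fix u assume u: "u \<in> {u. binary_word u \<and> length u = i \<and> take m u = w}"
    then obtain p where "p < 2 ^ i" "?window p = u" using ex1 by blast
    then show "u \<in> ?window ` {r. r < 2 ^ i \<and> take m (rotate r s) = w}"
      using u prefix[of p] by auto
  qed
  then show ?thesis
    using card_binary_words_prefix[OF assms(2-4)] by (simp add: bij_betw_same_card)
qed

lemma de_bruijn_zero_mem:
  assumes "de_bruijn i s" and "i \<ge> 1"
  shows "0 \<in> set s"
proof -
  obtain p where "take i (rotate p s) = replicate i 0"
    using assms(1) unfolding de_bruijn_def binary_word_def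
    by (metis empty_subsetI insertI1 insert_subset length_replicate set_replicate_conv_if)
  then have "0 \<in> set (take i (rotate p s))" using assms(2) by simp
  then show ?thesis by (auto dest!: in_set_takeD)
qed

section \<open>Block structure of the limit sequence\<close>

lemma length_word_power [simp]: "length (word_power w t) = t * length w"
  by (induction t) (auto simp: word_power_def)

lemma nth_word_power:
  assumes "n < t * length w"
  shows "word_power w t ! n = w ! (n mod length w)"
  using assms
proof (induction t arbitrary: n)
  case (Suc t)
  have "word_power w (Suc t) = w @ word_power w t" by (simp add: word_power_def)
  then show ?case
    using Suc.IH[of "n - length w"] Suc.prems by (auto simp: nth_append le_mod_geq)
qed simp

lemma power_concat_limit_block:
  assumes "\<And>i. i \<ge> 1 \<Longrightarrow> de_bruijn i (B i)" and "n < Suc k ^ Suc k * 2 ^ Suc k"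
  shows "power_concat_limit B (length (power_concat B k) + n) = B (Suc k) ! (n mod 2 ^ Suc k)"
proof -
  have len: "length (B i) = 2 ^ i" if "i \<ge> 1" for i
    using assms(1)[OF that] by (simp add: de_bruijn_def)
  have "B i \<noteq> []" if "i \<ge> 1" for i
    using len[OF that] by auto
  then have "power_concat_limit B (length (power_concat B k) + n)
      = power_concat B (Suc k) ! (length (power_concat B k) + n)"
    using assms(2) len[of "Suc k"] by (intro power_concat_limit_eq) (auto simp: power_concat_Suc)
  also have "\<dots> = B (Suc k) ! (n mod 2 ^ Suc k)"
    using assms(2) len[of "Suc k"] nth_word_power[of n "Suc k ^ Suc k" "B (Suc k)"]
    by (simp add: power_concat_Suc)
  finally show ?thesis .
qed

text \<open>Inside the power, running over the end of a copy continues at the start of the next one,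
  which is the same as reading a single copy cyclically. The bound on \<open>n + m\<close> keeps the
  window inside the power.\<close>

lemma power_concat_limit_window:
  assumes "\<And>i. i \<ge> 1 \<Longrightarrow> de_bruijn i (B i)"
    and "n + m \<le> Suc k ^ Suc k * 2 ^ Suc k" and "m \<le> 2 ^ Suc k"
  shows "map (power_concat_limit B)
      [length (power_concat B k) + n..<length (power_concat B k) + n + m]
    = take m (rotate n (B (Suc k)))"
proof (rule nth_equalityI)
  have len: "length (B (Suc k)) = 2 ^ Suc k"
    using assms(1)[of "Suc k"] by (simp add: de_bruijn_def)
  then show "length (map (power_concat_limit B)
      [length (power_concat B k) + n..<length (power_concat B k) + n + m])
      = length (take m (rotate n (B (Suc k))))"
    using assms(3) by simp
  fix l assume "l < length (map (power_concat_limit B)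
      [length (power_concat B k) + n..<length (power_concat B k) + n + m])"
  then have "l < m" by simp
  then show "map (power_concat_limit B)
      [length (power_concat B k) + n..<length (power_concat B k) + n + m] ! l
      = take m (rotate n (B (Suc k))) ! l"
    using power_concat_limit_block[OF assms(1), of "n + l" k] assms(2,3) len
    by (simp add: nth_rotate add.assoc del: power_Suc)
qed

section \<open>Deviation from the expected number of occurrences\<close>

text \<open>Only the start of the window is indexed, so a window may run past the end of the range
  of summation. This makes the sums additive over adjacent intervals, which
  \<open>occurrences\<close> is not.\<close>

definition deviation :: "(nat \<Rightarrow> nat) \<Rightarrow> nat list \<Rightarrow> nat \<Rightarrow> real" where
  "deviation x w n = of_bool (map x [n..<n + length w] = w) - 1 / 2 ^ length w"

lemma abs_deviation_le: "\<bar>deviation x w n\<bar> \<le> 1"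
proof -
  have "1 / 2 ^ length w \<le> (1 :: real)" "0 \<le> 1 / (2 :: real) ^ length w" by simp_all
  then show ?thesis
    using zero_less_eq_of_bool of_bool_less_eq_one unfolding deviation_def by (smt (verit))
qed

lemma abs_sum_deviation_le:
  assumes "finite A"
  shows "\<bar>\<Sum>n\<in>A. deviation x w (f n)\<bar> \<le> real (card A)"
  using sum_norm_bound[of A "\<lambda>n. deviation x w (f n)" 1] abs_deviation_le by simp

text \<open>The two counts differ only in windows that start before \<open>j\<close> and end after
  it, and these start in the last \<open>length w\<close> positions.\<close>

lemma abs_occurrences_minus_deviation_le:
  assumes "w \<noteq> []"
  shows "\<bar>real (occurrences x w j) - real j / 2 ^ length w - (\<Sum>n<j. deviation x w n)\<bar>
    \<le> real (length w)"
proof -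
  let ?P = "\<lambda>n. map x [n..<n + length w] = w"
  let ?S = "{n. n < j \<and> ?P n}" and ?O = "{n. n + length w \<le> j \<and> ?P n}"
  have "?S = {..<j} \<inter> {n. ?P n}" by auto
  then have dev: "(\<Sum>n<j. deviation x w n) = real (card ?S) - real j / 2 ^ length w"
    by (simp add: deviation_def sum_subtractf of_bool_def sum.If_cases)
  have sub: "?O \<subseteq> ?S" using assms by (cases w) auto
  then have "card ?O \<le> card ?S" by (intro card_mono) auto
  moreover have "?S \<subseteq> ?O \<union> {j - length w..<j}" by auto
  then have "card ?S \<le> card (?O \<union> {j - length w..<j})"
    by (intro card_mono) (auto intro: finite_subset[OF sub])
  then have "card ?S \<le> card ?O + length w"
    using card_Un_le[of ?O "{j - length w..<j}"] by simp
  ultimately show ?thesis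
    unfolding occurrences_def dev by linarith
qed

text \<open>The bound on \<open>Suc q\<close> says that another copy follows copy \<open>q\<close>,
  so all windows starting in copy \<open>q\<close> are cyclic ones. Each rotation is met once, and
  \<open>2 ^ (i - m)\<close> hits cancel against \<open>2 ^ i\<close> subtractions of
  \<open>1 / 2 ^ m\<close>.\<close>

lemma sum_deviation_copy:
  assumes db: "\<And>i. i \<ge> 1 \<Longrightarrow> de_bruijn i (B i)"
    and "binary_word w" and "length w \<le> Suc k" and "Suc q < Suc k ^ Suc k"
  shows "(\<Sum>n\<in>{q * 2 ^ Suc k..<q * 2 ^ Suc k + 2 ^ Suc k}.
    deviation (power_concat_limit B) w (length (power_concat B k) + n)) = 0"
proof -
  let ?i = "Suc k" and ?m = "length w"
  let ?P = "\<lambda>r. take ?m (rotate r (B ?i)) = w"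
  have len: "length (B ?i) = 2 ^ ?i"
    using db[of ?i] by (simp add: de_bruijn_def)
  have m: "?m \<le> 2 ^ ?i"
    using assms(3) less_exp[of ?i] by linarith
  have dev: "deviation (power_concat_limit B) w (length (power_concat B k) + (r + q * 2 ^ ?i))
      = of_bool (?P r) - 1 / 2 ^ ?m" if "r < 2 ^ ?i" for r
  proof -
    \<comment> \<open>A window starting in copy \<open>q\<close> is no longer than one copy, hence
      ends by the end of copy \<open>q + 1\<close>.\<close>
    have "r + q * 2 ^ ?i + ?m \<le> (q + 2) * 2 ^ ?i"
      using that m by (simp add: algebra_simps del: power_Suc)
    also have "\<dots> \<le> ?i ^ ?i * 2 ^ ?i"
      using assms(4) by (intro mult_right_mono) auto
    finally have "map (power_concat_limit B)
        [length (power_concat B k) + (r + q * 2 ^ ?i)..<length (power_concat B k) + (r + q * 2 ^ ?i) + ?m]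
        = take ?m (rotate (r + q * 2 ^ ?i) (B ?i))"
      by (intro power_concat_limit_window db m)
    also have "rotate (r + q * 2 ^ ?i) (B ?i) = rotate r (B ?i)"
      using len that by (subst rotate_conv_mod) (simp del: power_Suc)
    finally show ?thesis by (simp only: deviation_def)
  qed
  have "(\<Sum>n\<in>{q * 2 ^ ?i..<q * 2 ^ ?i + 2 ^ ?i}.
        deviation (power_concat_limit B) w (length (power_concat B k) + n))
      = (\<Sum>r<2 ^ ?i. deviation (power_concat_limit B) w (length (power_concat B k) + (r + q * 2 ^ ?i)))"
    using sum.shift_bounds_nat_ivl[of
      "\<lambda>n. deviation (power_concat_limit B) w (length (power_concat B k) + n)" 0 "q * 2 ^ ?i" "2 ^ ?i"]
    by (simp add: lessThan_atLeast0 add.commute del: power_Suc)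
  also have "\<dots> = (\<Sum>r<2 ^ ?i. of_bool (?P r) - 1 / 2 ^ ?m)"
    by (intro sum.cong refl dev) simp
  also have "\<dots> = real (card {r. r < 2 ^ ?i \<and> ?P r}) - 2 ^ ?i / 2 ^ ?m"
  proof -
    have "{r. r < 2 ^ ?i \<and> ?P r} = {..<2 ^ ?i} \<inter> {r. ?P r}" by auto
    then show ?thesis
      by (simp add: sum_subtractf of_bool_def sum.If_cases del: power_Suc)
  qed
  also have "\<dots> = 0"
    using de_bruijn_card_prefix[OF db[of ?i] assms(2) refl assms(3)] assms(3)
      power_diff[of "2 :: real" ?m ?i] by (simp del: power_Suc)
  finally show ?thesis .
qed

lemma abs_sum_deviation_block_le:
  assumes db: "\<And>i. i \<ge> 1 \<Longrightarrow> de_bruijn i (B i)"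
    and "binary_word w" and "length w \<le> Suc k" and "t \<le> Suc k ^ Suc k * 2 ^ Suc k"
  shows "\<bar>\<Sum>n<t. deviation (power_concat_limit B) w (length (power_concat B k) + n)\<bar> \<le> 2 ^ Suc k"
proof -
  let ?b = "2 ^ Suc k :: nat"
  let ?d = "\<lambda>n. deviation (power_concat_limit B) w (length (power_concat B k) + n)"
  \<comment> \<open>Rounding \<open>t - 1\<close> instead of \<open>t\<close> keeps \<open>q\<close> below the number of copies even if \<open>t\<close> is the end of the
    block, so that none of the copies before \<open>q\<close> is the last one.\<close>
  define q where "q = (t - 1) div ?b"
  have "(t - 1) mod ?b < ?b" by simp
  then have q: "q * ?b \<le> t" "t \<le> q * ?b + ?b"
    using div_mult_mod_eq[of "t - 1" ?b] unfolding q_def by linarith+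
  have "q < Suc k ^ Suc k"
  proof (cases "t = 0")
    case False
    then show ?thesis
      using assms(4) unfolding q_def by (intro less_mult_imp_div_less) linarith
  qed (simp add: q_def)
  have "(\<Sum>n<q * ?b. ?d n) = (\<Sum>p<q. \<Sum>n\<in>{p * ?b..<p * ?b + ?b}. ?d n)"
    by (rule sum.nat_group[symmetric])
  also have "\<dots> = 0"
    using \<open>q < Suc k ^ Suc k\<close> by (intro sum.neutral ballI sum_deviation_copy assms) auto
  finally have "(\<Sum>n<t. ?d n) = (\<Sum>n\<in>{q * ?b..<t}. ?d n)"
    using sum.atLeastLessThan_concat[of 0 "q * ?b" t ?d] q by (simp add: lessThan_atLeast0)
  moreover have "\<bar>\<Sum>n\<in>{q * ?b..<t}. ?d n\<bar> \<le> real (t - q * ?b)"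
    using abs_sum_deviation_le[of "{q * ?b..<t}"] by simp
  moreover have "real (t - q * ?b) \<le> real ?b"
    using q by (intro of_nat_mono) linarith
  ultimately show ?thesis by simp
qed

section \<open>Summation over the blocks and comparison with the position\<close>

lemma sum_lessThan_add:
  fixes f :: "nat \<Rightarrow> 'a :: comm_monoid_add"
  shows "(\<Sum>n<a + t. f n) = (\<Sum>n<a. f n) + (\<Sum>n<t. f (a + n))"
  by (induction t) (auto simp: add.assoc)

lemma length_power_concat_Suc:
  assumes "\<And>i. i \<ge> 1 \<Longrightarrow> de_bruijn i (B i)"
  shows "length (power_concat B (Suc k)) = length (power_concat B k) + Suc k ^ Suc k * 2 ^ Suc k"
  using assms[of "Suc k"] by (simp add: power_concat_Suc de_bruijn_def)

text \<open>The blocks up to order \<open>length w\<close> are bounded trivially by their length.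
  Each later block contributes at most \<open>2 ^ Suc k\<close>, which the doubling of the bound
  from \<open>k\<close> to \<open>Suc k\<close> absorbs.\<close>

lemma abs_sum_deviation_power_concat_le:
  assumes db: "\<And>i. i \<ge> 1 \<Longrightarrow> de_bruijn i (B i)"
    and "binary_word w" and "length w \<le> k"
  shows "\<bar>\<Sum>n<length (power_concat B k). deviation (power_concat_limit B) w n\<bar>
    \<le> real (length (power_concat B (length w))) + 2 ^ Suc k"
  using assms(3)
proof (induction k rule: dec_induct)
  case base
  show ?case
    using abs_sum_deviation_le[of "{..<length (power_concat B (length w))}" _ _ "\<lambda>n. n"]
    by (simp add: add_increasing2)
next
  case (step k)
  let ?d = "deviation (power_concat_limit B) w"
  have "(\<Sum>n<length (power_concat B (Suc k)). ?d n) = (\<Sum>n<length (power_concat B k). ?d n)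
      + (\<Sum>n<Suc k ^ Suc k * 2 ^ Suc k. ?d (length (power_concat B k) + n))"
    by (simp only: length_power_concat_Suc[OF db] sum_lessThan_add)
  moreover have "\<bar>\<Sum>n<Suc k ^ Suc k * 2 ^ Suc k. ?d (length (power_concat B k) + n)\<bar> \<le> 2 ^ Suc k"
    using step.hyps by (intro abs_sum_deviation_block_le db assms(2)) auto
  ultimately show ?case
    using step.IH power_Suc[of "2 :: real" "Suc k"] by linarith
qed

lemma power_concat_block_exists:
  assumes db: "\<And>i. i \<ge> 1 \<Longrightarrow> de_bruijn i (B i)" and "length (power_concat B K) \<le> j"
  obtains k t where "k \<ge> K" and "j = length (power_concat B k) + t"
    and "t \<le> Suc k ^ Suc k * 2 ^ Suc k"
proof -
  have "B i \<noteq> []" if "i \<ge> 1" for i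
    using db[OF that] by (auto simp: de_bruijn_def)
  then have ge: "k \<le> length (power_concat B k)" for k
    by (rule length_power_concat_ge)
  let ?Q = "\<lambda>k. k \<ge> K \<and> length (power_concat B k) \<le> j"
  define k where "k = (GREATEST k. ?Q k)"
  \<comment> \<open>Since \<open>k\<close> is at most the length of \<open>power_concat B k\<close>,
    all candidates are bounded by \<open>j\<close> and the greatest one exists.\<close>
  have bound: "\<And>k. ?Q k \<Longrightarrow> k \<le> j" using ge le_trans by blast
  have k: "?Q k" unfolding k_def by (rule GreatestI_nat[of ?Q K j]) (use assms(2) bound in auto)
  moreover have "\<not> ?Q (Suc k)"
    using Greatest_le_nat[of ?Q "Suc k" j] bound unfolding k_def by fastforce
  ultimately have "j < length (power_concat B (Suc k))" by simp
  then show ?thesis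
    using that[of k "j - length (power_concat B k)"] k length_power_concat_Suc[OF db, of k] by simp
qed

lemma sum_deviation_smallo:
  assumes db: "\<And>i. i \<ge> 1 \<Longrightarrow> de_bruijn i (B i)" and "binary_word w"
  shows "(\<lambda>j. \<Sum>n<j. deviation (power_concat_limit B) w n) \<in> o(\<lambda>j. real j)"
proof (rule landau_o.smallI)
  fix c :: real assume "c > 0"
  let ?d = "deviation (power_concat_limit B) w"
  let ?L = "\<lambda>k. length (power_concat B k)"
  define C where "C = real (?L (length w))"
  obtain N :: nat where "8 / c \<le> real N" using real_arch_simple by blast
  \<comment> \<open>Half of \<open>c * j\<close> is reserved for the constant \<open>C\<close>, the
    other half for \<open>4 * 2 ^ k\<close>. As \<open>j\<close> is at least
    \<open>k * 2 ^ k\<close>, the latter needs \<open>8 / c \<le> k\<close>.\<close>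
  then obtain K where K: "K \<ge> 1" "K \<ge> length w" "8 / c \<le> real K"
    using that[of "Suc (N + length w)"] by simp
  have bound: "\<bar>\<Sum>n<j. ?d n\<bar> \<le> c * real j" if j: "j \<ge> ?L K" "2 * C / c \<le> real j" for j
  proof -
    obtain k t where kt: "k \<ge> K" "j = ?L k + t" "t \<le> Suc k ^ Suc k * 2 ^ Suc k"
      by (rule power_concat_block_exists[OF db j(1)])
    have "\<bar>\<Sum>n<j. ?d n\<bar> \<le> \<bar>\<Sum>n<?L k. ?d n\<bar> + \<bar>\<Sum>n<t. ?d (?L k + n)\<bar>"
      unfolding kt(2) sum_lessThan_add by (rule abs_triangle_ineq)
    \<comment> \<open>The completed blocks and the current one contribute \<open>2 * 2 ^ k\<close>
      each.\<close>
    also have "\<dots> \<le> C + 4 * 2 ^ k"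
      using abs_sum_deviation_power_concat_le[OF db assms(2), of k]
        abs_sum_deviation_block_le[OF db assms(2) _ kt(3)] K(2) kt(1)
      by (simp add: C_def)
    also have "4 * 2 ^ k \<le> c / 2 * real j"
    proof -
      obtain l where l: "k = Suc l" using K(1) kt(1) by (cases k) auto
      \<comment> \<open>The last completed block alone suffices, even with its exponent
        \<open>k ^ k\<close> weakened to \<open>k\<close>: any factor that tends to infinity would
        do.\<close>
      have "k * 2 ^ k \<le> k ^ k * 2 ^ k"
        using l self_le_power[of k k] by (intro mult_right_mono) auto
      also have "\<dots> \<le> j"
        using length_power_concat_Suc[OF db, of l] kt(2) l by simp
      finally have "real k * 2 ^ k \<le> real j"
        by (metis of_nat_le_iff of_nat_mult of_nat_numeral of_nat_power)
      moreover have "8 \<le> c * real k"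
      proof -
        have "8 / c \<le> real k" using K(3) kt(1) by linarith
        then show ?thesis using \<open>c > 0\<close> by (simp add: field_simps)
      qed
      then have "8 * 2 ^ k \<le> c * (real k * 2 ^ k)"
        unfolding mult.assoc[symmetric] by (intro mult_right_mono) auto
      ultimately have "8 * 2 ^ k \<le> c * real j"
        using mult_left_mono[of "real k * 2 ^ k" "real j" c] \<open>c > 0\<close> by linarith
      then show ?thesis by simp
    qed
    also have "C \<le> c / 2 * real j" using j(2) \<open>c > 0\<close> by (simp add: field_simps)
    finally show ?thesis by simp
  qed
  show "\<forall>\<^sub>F j in sequentially. norm (\<Sum>n<j. ?d n) \<le> c * norm (real j)"
    using eventually_ge_at_top[of "max (?L K) (nat \<lceil>2 * C / c\<rceil>)"]
  proof eventually_elim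
    case (elim j)
    then have "2 * C / c \<le> real j" by linarith
    then show ?case using bound[of j] elim by simp
  qed
qed

theorem lemma2:
  fixes B :: "nat \<Rightarrow> nat list" and \<alpha> :: real
  assumes "\<And>i. i \<ge> 1 \<Longrightarrow> de_bruijn i (B i)"
    and "\<alpha> \<in> {0..<1}"
    and "has_binary_expansion \<alpha> (power_concat_limit B)"
  shows "normal_base2 \<alpha>"
proof -
  let ?x = "power_concat_limit B"
  \<comment> \<open>The block of order \<open>Suc N\<close> starts at position \<open>N\<close> or
    later, and already its first copy contains a 0.\<close>
  have zeros: "\<exists>n\<ge>N. ?x n = 0" for N
  proof -
    obtain r where "r < length (B (Suc N))" "B (Suc N) ! r = 0"
      using de_bruijn_zero_mem[OF assms(1), of "Suc N"] by (auto simp: in_set_conv_nth)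
    then have r: "r < 2 ^ Suc N" "B (Suc N) ! r = 0"
      using assms(1)[of "Suc N"] by (auto simp: de_bruijn_def)
    have "1 * 2 ^ Suc N \<le> Suc N ^ Suc N * (2 ^ Suc N :: nat)"
      by (intro mult_right_mono) (simp_all del: power_Suc)
    with r(1) have "r < Suc N ^ Suc N * 2 ^ Suc N" by linarith
    then have "?x (length (power_concat B N) + r) = 0"
      using power_concat_limit_block[OF assms(1), of r N] r by (simp del: power_Suc)
    moreover have "B i \<noteq> []" if "i \<ge> 1" for i
      using assms(1)[OF that] by (auto simp: de_bruijn_def)
    then have "N \<le> length (power_concat B N)" by (rule length_power_concat_ge)
    ultimately show ?thesis by (meson trans_le_add1)
  qed
  have digits: "binary_digit \<alpha> = ?x"
    using binary_digit_unique[OF assms(3) zeros] by blast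
  show ?thesis
    unfolding normal_base2_def digits
  proof (intro allI impI)
    fix m w assume m: "m \<ge> 1" and w: "binary_word w \<and> length w = m"
    let ?D = "\<lambda>j. \<Sum>n<j. deviation ?x w n"
    have "w \<noteq> []" using m w by auto
    \<comment> \<open>Replacing the occurrence count by the sum of deviations costs only a bounded
      error.\<close>
    then have "(\<lambda>j. real (occurrences ?x w j) - real j / 2 ^ m - ?D j) \<in> O(\<lambda>_. 1)"
      using abs_occurrences_minus_deviation_le[of w ?x] w
      by (intro bigoI[of _ "real m"] always_eventually) auto
    also have "(\<lambda>_. 1) \<in> o(\<lambda>j. real j)"
      by (intro smalloI_tendsto) (auto intro: lim_1_over_n eventually_gt_at_top[of 0, THEN eventually_mono])
    finally have "(\<lambda>j. (real (occurrences ?x w j) - real j / 2 ^ m - ?D j) + ?D j) \<in> o(\<lambda>j. real j)"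
      using sum_deviation_smallo[OF assms(1), of w] w by (intro sum_in_smallo(1)) auto
    then show "(\<lambda>j. real (occurrences ?x w j) - real j / 2 ^ m) \<in> o(\<lambda>j. real j)" by simp
  qed
qed

end
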